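(* For every integer $k\ge0$, all $P,Q\in\mathcal{P}$ and all $t\in[0,1]$, with $R(t)=(Q-P)t+P$, $$\mathrm{PL}_k(P\|R(t))=\Psi^k[\mathrm{PL}_0](P\|R(t)).$$ Furthermore, each $\mathrm{PL}_k$ ($k\ge0$) is a right-convex divergence, and $\{\mathrm{PL}_k(P\|R(t))\}_{k\ge0}$ is a monotonically decreasing (i.e. non-increasing in $k$) sequence.
   Context: $(\Sigma,\mathcal{M})$ is a measurable space and $\mathcal{P}$ is a set of probability distributions (measures) on it with common support, containing with $P,Q$ every mixture $R(t):=(Q-P)t+P$, $t\in[0,1]$. $p,q$ denote the Radon-Nikodym derivatives of $P,Q$ with respect to a positive measure $\mu$ (e.g. Lebesgue or counting measure), and integrals are over the common support (where $p,q>0$). A divergence is a function $D:\mathcal{P}\times\mathcal{P}\to[0,\infty]$ such that, for all $P,Q\in\mathcal{P}$, $D(P\|Q)\ge 0$, and $D(P\|Q)=0$ if and only if $P=Q$. It is right-convex if it is convex in the second argument: $\lambda D(P\|Q_1)+(1-\lambda)D(P\|Q_2)\ge D(P\|\lambda Q_1+(1-\lambda)Q_2)$ for all $P,Q_1,Q_2\in\mathcal{P}$ and $\lambda\in[0,1]$. Integral operator: when $\frac1t D(P\|R(t))$ is integrable on $[0,1]$ (Lebesgue measure), define $\Psi[D](P\|R(t)):=\int_0^t\frac1s D(P\|R(s))\,ds$. The right-hand side depends only on $P$ and the distribution $R(t)$, so $\Psi[D]$ is a well-defined function on $\mathcal{P}\times\mathcal{P}$; equivalently, $\Psi[D](P\|Q)=\int_0^1\frac1s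 D(P\|(Q-P)s+P)\,ds$. Iterates: $\Psi^0$ is the identity operator and $\Psi^{k+1}:=\Psi\circ\Psi^k$ for $k\ge0$. Polylogarithm: $\mathrm{Li}_0(z):=\frac{z}{1-z}$ and, for $k>0$, $\mathrm{Li}_k(z):=\frac{z}{\Gamma(k)}\int_0^\infty\frac{x^{k-1}}{e^x-z}\,dx$ (used here for real $z<1$). For $k\ge0$, $\mathrm{PL}_k:\mathcal{P}\times\mathcal{P}\to\mathbb{R}$ is defined by $\mathrm{PL}_k(P\|Q):=\int p\,\mathrm{Li}_k\left(1-\frac{q}{p}\right)d\mu$; these functions are real-valued, i.e. the integrals are assumed finite on $\mathcal{P}\times\mathcal{P}$. *)

theory Defs
  imports "HOL-Probability.Probability"
begin

(* mixture t P Q is the measure R(t) = (Q - P) t + P = (1 - t) P + t Q, for t in [0,1]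
   and P, Q on the same measurable space. *)
definition mixture :: "real \<Rightarrow> 'a measure \<Rightarrow> 'a measure \<Rightarrow> 'a measure" where
  "mixture t P Q =
     measure_of (space P) (sets P)
       (\<lambda>A. ennreal (1 - t) * emeasure P A + ennreal t * emeasure Q A)"

lemma space_mixture [simp]: "space (mixture t P Q) = space P"
  unfolding mixture_def by (simp add: space_measure_of_conv)

lemma sets_mixture [simp]: "sets (mixture t P Q) = sets P"
  unfolding mixture_def by simp

lemma emeasure_mixture:
  assumes "sets P = sets Q" and "A \<in> sets P"
  shows "emeasure (mixture t P Q) A
           = ennreal (1 - t) * emeasure P A + ennreal t * emeasure Q A"
  unfolding mixture_def
proof (rule emeasure_measure_of_sigma)
  let ?f = "\<lambda>A. ennreal (1 - t) * emeasure P A + ennreal t * emeasure Q A"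
  show "sigma_algebra (space P) (sets P)" by (rule sets.sigma_algebra_axioms)
  show "positive (sets P) ?f" by (simp add: positive_def)
  show "countably_additive (sets P) ?f"
  proof (rule countably_additiveI)
    fix B :: "nat \<Rightarrow> 'a set"
    assume B: "range B \<subseteq> sets P" "disjoint_family B"
    have "(\<Sum>i. ?f (B i)) =
        ennreal (1 - t) * (\<Sum>i. emeasure P (B i)) + ennreal t * (\<Sum>i. emeasure Q (B i))"
      by (simp add: suminf_add[symmetric])
    also have "\<dots> = ?f (\<Union>i. B i)"
      using B assms(1) by (simp add: suminf_emeasure)
    finally show "(\<Sum>i. ?f (B i)) = ?f (\<Union>i. B i)" .
  qed
qed (use assms in auto)

lemma mixture_mixture:
  assumes "sets P = sets Q" "0 \<le> s" "s \<le> 1" "0 \<le> t" "t \<le> 1"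
  shows "mixture s P (mixture t P Q) = mixture (t * s) P Q"
proof (rule measure_eqI)
  fix A assume "A \<in> sets (mixture s P (mixture t P Q))"
  then have A: "A \<in> sets P" by simp
  have e1: "ennreal (1 - s) + ennreal s * ennreal (1 - t) = ennreal (1 - t * s)"
  proof -
    have "ennreal (1 - s) + ennreal s * ennreal (1 - t) = ennreal ((1 - s) + s * (1 - t))"
      using assms by (simp only: ennreal_mult ennreal_plus diff_ge_0_iff_ge mult_nonneg_nonneg)
    also have "(1 - s) + s * (1 - t) = 1 - t * s" by (simp add: algebra_simps)
    finally show ?thesis .
  qed
  have e2: "ennreal s * ennreal t = ennreal (t * s)"
    using assms by (simp only: ennreal_mult mult.commute)
  have "ennreal (1 - s) * x + ennreal s * (ennreal (1 - t) * x + ennreal t * y)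
          = ennreal (1 - t * s) * x + ennreal (t * s) * y"
    for x y :: ennreal
    unfolding e1[symmetric] e2[symmetric] by (simp only: distrib_left distrib_right ac_simps)
  then show "emeasure (mixture s P (mixture t P Q)) A = emeasure (mixture (t * s) P Q) A"
    using A assms by (simp add: emeasure_mixture)
qed simp

definition dens :: "'a measure \<Rightarrow> 'a measure \<Rightarrow> 'a \<Rightarrow> real" where
  "dens \<mu> P x = enn2real (RN_deriv \<mu> P x)"

(* RN_deriv returns a junk value when no density exists.  No sigma-finiteness of the reference
   measure is required. *)
definition has_dens :: "'a measure \<Rightarrow> 'a measure \<Rightarrow> bool" where
  "has_dens \<mu> P \<longleftrightarrow> (\<exists>f \<in> borel_measurable \<mu>. density \<mu> f = P)"

(* Densities are determined up to null sets only, hence so is their common support. *)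
definition common_support :: "'a measure \<Rightarrow> 'a measure set \<Rightarrow> bool" where
  "common_support \<mu> \<P> \<longleftrightarrow>
     (\<exists>S \<in> sets \<mu>. \<forall>P \<in> \<P>. AE x in \<mu>. x \<in> S \<longleftrightarrow> 0 < dens \<mu> P x)"

definition divergence_on ::
    "'a measure set \<Rightarrow> ('a measure \<Rightarrow> 'a measure \<Rightarrow> ereal) \<Rightarrow> bool" where
  "divergence_on \<P> D \<longleftrightarrow>
     (\<forall>P \<in> \<P>. \<forall>Q \<in> \<P>. 0 \<le> D P Q \<and> (D P Q = 0 \<longleftrightarrow> P = Q))"

definition right_convex_on ::
    "'a measure set \<Rightarrow> ('a measure \<Rightarrow> 'a measure \<Rightarrow> ereal) \<Rightarrow> bool" where
  "right_convex_on \<P> D \<longleftrightarrow>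
     (\<forall>P \<in> \<P>. \<forall>Q1 \<in> \<P>. \<forall>Q2 \<in> \<P>. \<forall>l \<in> {0..1}.
        D P (mixture l Q2 Q1) \<le> ereal l * D P Q1 + ereal (1 - l) * D P Q2)"

definition Psi_defined_on ::
    "'a measure set \<Rightarrow> ('a measure \<Rightarrow> 'a measure \<Rightarrow> real) \<Rightarrow> bool" where
  "Psi_defined_on \<P> D \<longleftrightarrow>
     (\<forall>P \<in> \<P>. \<forall>Q \<in> \<P>.
        set_integrable lborel {0..1} (\<lambda>s. 1 / s * D P (mixture s P Q)))"

(* Meaningful only under Psi_defined_on: the Bochner integral of a non-integrable function is 0. *)
definition Psi ::
    "('a measure \<Rightarrow> 'a measure \<Rightarrow> real) \<Rightarrow> 'a measure \<Rightarrow> 'a measure \<Rightarrow> real" where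
  "Psi D P Q = (LINT s:{0..1}|lborel. 1 / s * D P (mixture s P Q))"

(* At t = 0 the right-hand side is 0, and so is the left-hand side as soon as D P P = 0. *)
lemma Psi_mixture:
  assumes "sets P = sets Q" "0 < t" "t \<le> 1"
  shows "Psi D P (mixture t P Q) = (LINT s:{0..t}|lborel. 1 / s * D P (mixture s P Q))"
proof -
  have "(LINT s:{0..t}|lborel. 1 / s * D P (mixture s P Q))
      = t * (LINT x|lborel. indicator {0..t} (t * x) * (1 / (t * x) * D P (mixture (t * x) P Q)))"
    unfolding set_lebesgue_integral_def
    using lborel_integral_real_affine[of t
        "\<lambda>s. indicator {0..t} s *\<^sub>R (1 / s * D P (mixture s P Q))" 0] assms by simp
  also have "\<dots> = (LINT x|lborel. t * (indicator {0..t} (t * x) *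
      (1 / (t * x) * D P (mixture (t * x) P Q))))"
    by (rule integral_mult_right_zero[symmetric])
  also have "\<dots> = (LINT x|lborel. indicator {0..1} x *\<^sub>R
      (1 / x * D P (mixture x P (mixture t P Q))))"
  proof (rule Bochner_Integration.integral_cong)
    fix x :: real
    have "(indicator {0..t} (t * x) :: real) = indicator {0..1} x"
      using assms by (auto simp: indicator_def zero_le_mult_iff)
    moreover have "x \<in> {0..1} \<Longrightarrow> mixture x P (mixture t P Q) = mixture (t * x) P Q"
      using assms by (intro mixture_mixture) auto
    ultimately show "t * (indicator {0..t} (t * x) * (1 / (t * x) * D P (mixture (t * x) P Q)))
        = indicator {0..1} x *\<^sub>R (1 / x * D P (mixture x P (mixture t P Q)))"
      using assms by (cases "x \<in> {0..1}") auto
  qed simp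
  finally show ?thesis unfolding Psi_def set_lebesgue_integral_def by simp
qed

(* Used for z < 1. *)
definition polylog :: "nat \<Rightarrow> real \<Rightarrow> real" where
  "polylog k z =
     (if k = 0 then z / (1 - z)
      else z / Gamma (real k) * (LINT x:{0..}|lborel. x ^ (k - 1) / (exp x - z)))"

definition supp2 :: "'a measure \<Rightarrow> 'a measure \<Rightarrow> 'a measure \<Rightarrow> 'a set" where
  "supp2 \<mu> P Q = {x \<in> space \<mu>. 0 < dens \<mu> P x \<and> 0 < dens \<mu> Q x}"

definition PL_integrand :: "'a measure \<Rightarrow> nat \<Rightarrow> 'a measure \<Rightarrow> 'a measure \<Rightarrow> 'a \<Rightarrow> real" where
  "PL_integrand \<mu> k P Q x = dens \<mu> P x * polylog k (1 - dens \<mu> Q x / dens \<mu> P x)"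

definition PL :: "'a measure \<Rightarrow> nat \<Rightarrow> 'a measure \<Rightarrow> 'a measure \<Rightarrow> real" where
  "PL \<mu> k P Q = (LINT x:supp2 \<mu> P Q|\<mu>. PL_integrand \<mu> k P Q x)"

end

theory Submission
  imports Defs
begin

text \<open>Put \<open>u = 1 - q / p\<close>. The ratio of the density of \<open>R(s)\<close> to \<open>p\<close> is \<open>1 - s * u\<close>, so
\<open>PL\<^sub>k(P, R(s))\<close> is the \<open>P\<close>-integral of \<open>Li\<^sub>k(s * u)\<close>, and every part of the proposition reduces to a
property of the polylogarithm on \<open>z < 1\<close>.

The central identity is \<open>Li\<^sub>k\<^sub>+\<^sub>1(z) = \<integral>\<^sub>0\<^sup>1 Li\<^sub>k(s * z) / s ds\<close> (\<open>has_bochner_integral_polylog_Suc\<close>), obtained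
from the integral representation by Tonelli's theorem. Integrating it against \<open>P\<close> and exchanging the two
integrals says that \<open>\<Psi>\<close> maps \<open>PL\<^sub>k\<close> to \<open>PL\<^sub>k\<^sub>+\<^sub>1\<close> (\<open>Psi_PL\<close>). The exchange is legitimate because
\<open>Li\<^sub>k(z) \<ge> z\<close>: the difference is nonnegative, and the subtracted \<open>u\<close> has mean zero under \<open>P\<close>
(\<open>integral_polylog_Suc\<close>). Working under the finite measure \<open>P\<close> instead of the reference measure also
supplies the sigma-finiteness that Fubini's theorem asks for.

The other parts follow from the same identity by induction on \<open>k\<close>. \<open>Li\<^sub>k(z) - z\<close> is nonnegative and
vanishes only at 0 (\<open>polylog_ge\<close>), which makes \<open>PL\<^sub>k\<close> a divergence. \<open>Li\<^sub>k\<close> is convex (\<open>convex_on_polylog\<close>)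
and \<open>u\<close> is affine in the second distribution (\<open>deficit_mixture\<close>), which gives right-convexity. Convexity
and \<open>Li\<^sub>k(0) = 0\<close> yield \<open>Li\<^sub>k(s * z) / s \<le> Li\<^sub>k(z)\<close>, and averaging this over \<open>s\<close> gives
\<open>Li\<^sub>k\<^sub>+\<^sub>1 \<le> Li\<^sub>k\<close> (\<open>polylog_Suc_le\<close>), hence the monotonicity in \<open>k\<close>.\<close>

section \<open>The polylogarithm as an iterated integral\<close>

lemma exp_gt_of_less_1:
  fixes z x :: real
  assumes "z < 1" "0 \<le> x"
  shows "z < exp x"
  using assms by (smt (verit) one_le_exp_iff)

lemma scaled_less_1:
  fixes z s :: real
  assumes "z < 1" "0 \<le> s" "s \<le> 1"
  shows "s * z < 1"
proof (cases "0 \<le> z")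
  case True
  then show ?thesis using assms mult_right_mono[of s 1 z] by simp
next
  case False
  then show ?thesis using assms mult_nonneg_nonpos[of s z] by simp
qed

text \<open>Up to normalisation this is the Bose-Einstein integral. Splitting it off isolates the sign of
\<open>polylog (Suc k) z\<close> in the factor \<open>z\<close>, so that what remains to be integrated is nonnegative and
Tonelli's theorem applies to it.\<close>
definition bose_integral :: "nat \<Rightarrow> real \<Rightarrow> real" where
  "bose_integral k z = (LINT x:{0..}|lborel. x ^ k / (exp x - z))"

lemma polylog_Suc: "polylog (Suc k) z = z * (bose_integral k z / fact k)"
proof -
  have "Gamma (real (Suc k)) = fact k"
    using Gamma_fact[of k, where 'a = real] by (simp add: add.commute)
  then show ?thesis unfolding polylog_def bose_integral_def by simp
qed

lemma borel_measurable_polylog [measurable]: "polylog k \<in> borel_measurable borel"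
proof (cases k)
  case 0
  have "(\<lambda>z::real. z / (1 - z)) \<in> borel_measurable borel" by measurable
  then show ?thesis using 0 by (simp add: polylog_def[abs_def])
next
  case (Suc n)
  have "bose_integral n \<in> borel_measurable borel"
    unfolding bose_integral_def[abs_def] set_lebesgue_integral_def by measurable
  then show ?thesis unfolding Suc polylog_Suc[abs_def] by measurable
qed

text \<open>Domination by a Gamma integrand, which makes the integral converge for every \<open>z < 1\<close>. The two values
in the minimum serve \<open>z \<le> 0\<close> and \<open>z \<ge> 0\<close> respectively.\<close>
lemma bose_integrand_le:
  fixes x z :: real
  assumes z: "z < 1" and x: "0 \<le> x"
  shows "x ^ k / (exp x - z) \<le> x ^ k * exp (- x) / min 1 (1 - z)"
proof -
  let ?c = "min 1 (1 - z)"
  have c: "0 < ?c" using z by simp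
  have "?c * exp x \<le> exp x - z"
  proof (cases "0 \<le> z")
    case True
    then have "z * 1 \<le> z * exp x" using x by (intro mult_left_mono) auto
    then show ?thesis using True by (simp add: algebra_simps)
  next
    case False
    then show ?thesis by simp
  qed
  then have "x ^ k / (exp x - z) \<le> x ^ k / (?c * exp x)"
    using c x z exp_gt_of_less_1[OF z x] by (intro divide_left_mono mult_pos_pos) auto
  also have "\<dots> = x ^ k * exp (- x) / ?c"
    using c by (simp add: exp_minus field_simps)
  finally show ?thesis .
qed

lemma nn_integral_bose:
  assumes z: "z < 1"
  shows "(\<integral>\<^sup>+x. ennreal (x ^ k / (exp x - z)) * indicator {0..} x \<partial>lborel)
           = ennreal (bose_integral k z)"
proof -
  let ?f = "\<lambda>x. indicator {0..} x *\<^sub>R (x ^ k / (exp x - z))"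
  have eq: "ennreal (x ^ k / (exp x - z)) * indicator {0..} x = ennreal (?f x)" for x
    by (simp split: split_indicator)
  have nn: "0 \<le> ?f x" for x
    using exp_gt_of_less_1[OF z, of x] by (auto split: split_indicator)
  have "(\<integral>\<^sup>+x. ennreal (?f x) \<partial>lborel)
      \<le> (\<integral>\<^sup>+x. ennreal (1 / min 1 (1 - z)) *
            (ennreal (x ^ k * exp (- x)) * indicator {0..} x) \<partial>lborel)"
  proof (intro nn_integral_mono)
    fix x :: real
    show "ennreal (?f x) \<le> ennreal (1 / min 1 (1 - z)) *
            (ennreal (x ^ k * exp (- x)) * indicator {0..} x)"
      using bose_integrand_le[OF z, of x k] z
      by (auto split: split_indicator simp: ennreal_mult'[symmetric] intro!: ennreal_leI)
  qed
  also have "\<dots> = ennreal (1 / min 1 (1 - z)) * ennreal (fact k)"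
    by (subst nn_integral_cmult) (auto simp: nn_intergal_power_times_exp_Ici)
  also have "\<dots> < \<infinity>"
    by (simp add: ennreal_mult_less_top)
  finally have fin: "(\<integral>\<^sup>+x. ennreal (?f x) \<partial>lborel) < \<infinity>" .
  have "integrable lborel ?f"
    by (rule integrableI_nonneg[OF _ AE_I2[OF nn] fin]) simp
  then have "(\<integral>\<^sup>+x. ennreal (?f x) \<partial>lborel) = ennreal (integral\<^sup>L lborel ?f)"
    by (rule nn_integral_eq_integral[OF _ AE_I2[OF nn]])
  then show ?thesis
    unfolding bose_integral_def set_lebesgue_integral_def eq .
qed

lemma bose_integral_nonneg:
  assumes "z < 1"
  shows "0 \<le> bose_integral k z"
  unfolding bose_integral_def set_lebesgue_integral_def
  using exp_gt_of_less_1[OF assms]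
  by (intro integral_nonneg_AE) (auto split: split_indicator simp: less_imp_le)

text \<open>Formally this is the substitution \<open>s = exp (x - w)\<close>. Both sides are evaluated by the fundamental theorem
of calculus instead: for \<open>z \<noteq> 0\<close> each of them equals \<open>- ln (1 - z * exp (- x)) / z\<close>. The case \<open>x = 0\<close>
is the passage from \<open>Li\<^sub>0\<close> to \<open>Li\<^sub>1\<close>, general \<open>x\<close> is needed for all later ones.\<close>
lemma nn_integral_scaled_eq_tail:
  fixes x z :: real
  assumes z: "z < 1" "z \<noteq> 0" and x: "0 \<le> x"
  shows "(\<integral>\<^sup>+s. ennreal (1 / (exp x - s * z)) * indicator {0..1} s \<partial>lborel)
       = (\<integral>\<^sup>+w. ennreal (1 / (exp w - z)) * indicator {x..} w \<partial>lborel)"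
proof -
  have pos: "s * z < exp x" if "0 \<le> s" "s \<le> 1" for s
    using scaled_less_1[OF z(1) that] exp_gt_of_less_1 x by blast
  have "(\<integral>\<^sup>+s. ennreal (1 / (exp x - s * z)) * indicator {0..1} s \<partial>lborel)
      = ennreal (- ln (exp x - 1 * z) / z - (- ln (exp x - 0 * z) / z))"
  proof (rule nn_integral_FTC_Icc)
    show "DERIV (\<lambda>s. - ln (exp x - s * z) / z) s :> 1 / (exp x - s * z)"
      if "s \<in> {0..1}" for s
      using pos[of s] that z by (auto intro!: derivative_eq_intros simp: field_simps)
    show "0 \<le> 1 / (exp x - s * z)" if "s \<in> {0..1}" for s
      using pos[of s] that by simp
  qed simp_all
  also have "- ln (exp x - 1 * z) / z - (- ln (exp x - 0 * z) / z) = 0 - ln (1 - z * exp (- x)) / z"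
  proof -
    have "exp x - z = exp x * (1 - z * exp (- x))"
      by (simp add: right_diff_distrib exp_minus)
    moreover have "0 < 1 - z * exp (- x)"
      using scaled_less_1[OF z(1), of "exp (- x)"] x by (simp add: mult.commute)
    ultimately have "ln (exp x - z) = x + ln (1 - z * exp (- x))"
      by (simp add: ln_mult)
    then show ?thesis using z by (simp add: field_simps)
  qed
  also have "ennreal \<dots> = (\<integral>\<^sup>+w. ennreal (1 / (exp w - z)) * indicator {x..} w \<partial>lborel)"
  proof (rule nn_integral_FTC_atLeast[symmetric])
    fix w assume w: "x \<le> w"
    have lt: "z < exp w" using exp_gt_of_less_1[OF z(1), of w] w x by simp
    have "0 < 1 - z * exp (- w)"
      using lt by (simp add: exp_minus field_simps)
    then show "DERIV (\<lambda>w. ln (1 - z * exp (- w)) / z) w :> 1 / (exp w - z)"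
      using z lt by (auto intro!: derivative_eq_intros simp: field_simps exp_minus)
    show "0 \<le> 1 / (exp w - z)" using lt by simp
  next
    have "((\<lambda>w. ln (1 - z * exp (- w)) / z) \<longlongrightarrow> ln (1 - z * 0) / z) at_top"
      using z by (intro tendsto_intros filterlim_compose[OF exp_at_bot]
          filterlim_uminus_at_bot_at_top) auto
    then show "((\<lambda>w. ln (1 - z * exp (- w)) / z) \<longlongrightarrow> 0) at_top" by simp
  qed simp
  finally show ?thesis .
qed

text \<open>Two exchanges of integration. The first one brings the average over \<open>s\<close> inside, where it turns into a
tail integral over \<open>w \<ge> x\<close>; the second one integrates \<open>x ^ k\<close> over \<open>0 \<le> x \<le> w\<close> for fixed \<open>w\<close>, which
raises the power of the variable by one.\<close>
lemma nn_integral_bose_scaled: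
  assumes z: "z < 1" "z \<noteq> 0"
  shows "(\<integral>\<^sup>+s. ennreal (bose_integral k (s * z)) * indicator {0..1} s \<partial>lborel)
           = ennreal (bose_integral (Suc k) z / Suc k)"
proof -
  have "(\<integral>\<^sup>+s. ennreal (bose_integral k (s * z)) * indicator {0..1} s \<partial>lborel)
      = (\<integral>\<^sup>+s. (\<integral>\<^sup>+x. ennreal (x ^ k) * indicator {0..} x *
            (ennreal (1 / (exp x - s * z)) * indicator {0..1} s) \<partial>lborel) \<partial>lborel)"
  proof (intro nn_integral_cong)
    fix s :: real
    show "ennreal (bose_integral k (s * z)) * indicator {0..1} s
      = (\<integral>\<^sup>+x. ennreal (x ^ k) * indicator {0..} x *
            (ennreal (1 / (exp x - s * z)) * indicator {0..1} s) \<partial>lborel)"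
    proof (cases "s \<in> {0..1}")
      case True
      then have "s * z < 1" using scaled_less_1[OF z(1)] by simp
      from nn_integral_bose[OF this, of k, symmetric] show ?thesis
        using True by (auto intro!: nn_integral_cong split: split_indicator
            simp: ennreal_mult'[symmetric])
    qed simp
  qed
  also have "\<dots> = (\<integral>\<^sup>+x. (\<integral>\<^sup>+s. ennreal (x ^ k) * indicator {0..} x *
            (ennreal (1 / (exp x - s * z)) * indicator {0..1} s) \<partial>lborel) \<partial>lborel)"
    by (rule lborel_pair.Fubini') measurable
  also have "\<dots> = (\<integral>\<^sup>+x. ennreal (x ^ k) * indicator {0..} x *
            (\<integral>\<^sup>+w. ennreal (1 / (exp w - z)) * indicator {x..} w \<partial>lborel) \<partial>lborel)"
  proof (intro nn_integral_cong)
    fix x :: real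
    show "(\<integral>\<^sup>+s. ennreal (x ^ k) * indicator {0..} x *
            (ennreal (1 / (exp x - s * z)) * indicator {0..1} s) \<partial>lborel)
        = ennreal (x ^ k) * indicator {0..} x *
            (\<integral>\<^sup>+w. ennreal (1 / (exp w - z)) * indicator {x..} w \<partial>lborel)"
      using nn_integral_scaled_eq_tail[OF z, of x]
      by (cases "0 \<le> x") (simp_all add: nn_integral_cmult)
  qed
  also have "\<dots> = (\<integral>\<^sup>+x. (\<integral>\<^sup>+w. (ennreal (1 / (exp w - z)) * indicator {0..} w) *
            (ennreal (x ^ k) * indicator {0..w} x) \<partial>lborel) \<partial>lborel)"
    by (subst nn_integral_cmult[symmetric])
      (auto intro!: nn_integral_cong split: split_indicator simp: mult.commute)
  also have "\<dots> = (\<integral>\<^sup>+w. (\<integral>\<^sup>+x. (ennreal (1 / (exp w - z)) * indicator {0..} w) *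
            (ennreal (x ^ k) * indicator {0..w} x) \<partial>lborel) \<partial>lborel)"
    by (rule lborel_pair.Fubini') (unfold indicator_def atLeastAtMost_iff, measurable)
  also have "\<dots> = (\<integral>\<^sup>+w. ennreal (1 / Suc k) *
            (ennreal (w ^ Suc k / (exp w - z)) * indicator {0..} w) \<partial>lborel)"
  proof (intro nn_integral_cong)
    fix w :: real
    show "(\<integral>\<^sup>+x. (ennreal (1 / (exp w - z)) * indicator {0..} w) *
            (ennreal (x ^ k) * indicator {0..w} x) \<partial>lborel)
        = ennreal (1 / Suc k) * (ennreal (w ^ Suc k / (exp w - z)) * indicator {0..} w)"
    proof (cases "0 \<le> w")
      case True
      have "(\<integral>\<^sup>+x. ennreal (x ^ k) * indicator {0..w} x \<partial>lborel)
          = ennreal (w ^ Suc k / Suc k - 0 ^ Suc k / Suc k)"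
      proof (rule nn_integral_FTC_Icc)
        show "DERIV (\<lambda>x. x ^ Suc k / Suc k) x :> x ^ k" for x :: real
          by (rule derivative_eq_intros refl | simp)+
      qed (use True in auto)
      then show ?thesis
        using True exp_gt_of_less_1[OF z(1) True]
        by (simp add: nn_integral_cmult ennreal_mult'[symmetric] mult.commute del: power_Suc)
    qed simp
  qed
  also have "\<dots> = ennreal (1 / Suc k) * ennreal (bose_integral (Suc k) z)"
    by (subst nn_integral_cmult) (auto simp: nn_integral_bose[OF z(1), symmetric])
  finally show ?thesis
    by (simp add: ennreal_mult'[symmetric])
qed

lemma polylog_0_right [simp]: "polylog k 0 = 0"
  by (simp add: polylog_def)

text \<open>The integrated form of \<open>z * Li\<^sub>k\<^sub>+\<^sub>1'(z) = Li\<^sub>k(z)\<close>. It is the only link between consecutive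
polylogarithms that is used below; the bounds and the convexity follow from it by induction on \<open>k\<close>.\<close>
lemma has_bochner_integral_polylog_Suc:
  assumes z: "z < 1"
  shows "has_bochner_integral lborel (\<lambda>s. indicator {0..1} s *\<^sub>R (polylog k (s * z) / s))
           (polylog (Suc k) z)"
proof (cases "z = 0")
  case True
  then show ?thesis by (simp add: has_bochner_integral_zero)
next
  case False
  \<comment> \<open>Writing \<open>polylog k (s * z) = s * z * K s\<close> with \<open>K \<ge> 0\<close> reduces the claim to a nonnegative integral;
     only the formula for \<open>K\<close> depends on whether \<open>k\<close> is zero.\<close>
  obtain K :: "real \<Rightarrow> real" and I where
    K: "K \<in> borel_measurable borel" "\<And>s. s \<in> {0..1} \<Longrightarrow> 0 \<le> K s"
       "\<And>s. polylog k (s * z) = s * z * K s"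
    and I: "0 \<le> I" "polylog (Suc k) z = z * I"
       "(\<integral>\<^sup>+s. ennreal (K s) * indicator {0..1} s \<partial>lborel) = ennreal I"
  proof (cases k)
    case 0
    show thesis
    proof (rule that)
      show "(\<lambda>s. 1 / (1 - s * z)) \<in> borel_measurable borel" by measurable
      show "0 \<le> 1 / (1 - s * z)" if "s \<in> {0..1}" for s
        using scaled_less_1[OF z] that by (simp add: less_imp_le)
      show "polylog k (s * z) = s * z * (1 / (1 - s * z))" for s
        by (simp add: polylog_def 0)
      show "0 \<le> bose_integral 0 z" by (rule bose_integral_nonneg[OF z])
      show "polylog (Suc k) z = z * bose_integral 0 z" by (simp add: polylog_Suc 0)
      show "(\<integral>\<^sup>+s. ennreal (1 / (1 - s * z)) * indicator {0..1} s \<partial>lborel) = ennreal (bose_integral 0 z)"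
        using nn_integral_scaled_eq_tail[OF z False, of 0] nn_integral_bose[OF z, of 0] by simp
    qed
  next
    case (Suc n)
    show thesis
    proof (rule that)
      show "(\<lambda>s. bose_integral n (s * z) / fact n) \<in> borel_measurable borel"
        unfolding bose_integral_def set_lebesgue_integral_def by measurable
      show "0 \<le> bose_integral n (s * z) / fact n" if "s \<in> {0..1}" for s
        using bose_integral_nonneg scaled_less_1[OF z] that by simp
      show "polylog k (s * z) = s * z * (bose_integral n (s * z) / fact n)" for s
        by (simp add: polylog_Suc Suc)
      show "0 \<le> bose_integral (Suc n) z / fact (Suc n)"
        using bose_integral_nonneg[OF z] by simp
      show "polylog (Suc k) z = z * (bose_integral (Suc n) z / fact (Suc n))"
        unfolding Suc polylog_Suc ..
      have "(\<integral>\<^sup>+s. ennreal (bose_integral n (s * z) / fact n) * indicator {0..1} s \<partial>lborel)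
          = (\<integral>\<^sup>+s. ennreal (1 / fact n) *
              (ennreal (bose_integral n (s * z)) * indicator {0..1} s) \<partial>lborel)"
        using bose_integral_nonneg scaled_less_1[OF z]
        by (auto intro!: nn_integral_cong split: split_indicator simp: ennreal_mult'[symmetric])
      also have "\<dots> = ennreal (1 / fact n) * ennreal (bose_integral (Suc n) z / Suc n)"
        unfolding nn_integral_bose_scaled[OF z False, symmetric]
        by (rule nn_integral_cmult)
          (unfold bose_integral_def set_lebesgue_integral_def, measurable)
      also have "\<dots> = ennreal (bose_integral (Suc n) z / fact (Suc n))"
        by (simp add: ennreal_mult'[symmetric] mult.commute)
      finally show "(\<integral>\<^sup>+s. ennreal (bose_integral n (s * z) / fact n) * indicator {0..1} s \<partial>lborel)
          = ennreal (bose_integral (Suc n) z / fact (Suc n))" .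
    qed
  qed
  have "has_bochner_integral lborel (\<lambda>s. indicator {0..1} s * K s) I"
  proof (rule has_bochner_integral_nn_integral)
    show "(\<integral>\<^sup>+s. ennreal (indicator {0..1} s * K s) \<partial>lborel) = ennreal I"
      unfolding I(3)[symmetric] by (auto intro!: nn_integral_cong split: split_indicator)
    show "(\<lambda>s. indicator {0..1} s * K s) \<in> borel_measurable lborel"
      using K(1) by measurable
  qed (use K I in \<open>auto split: split_indicator\<close>)
  then have "has_bochner_integral lborel (\<lambda>s. z * (indicator {0..1} s * K s)) (z * I)"
    by (rule has_bochner_integral_mult_right)
  moreover have "AE s in lborel. z * (indicator {0..1} s * K s)
      = indicator {0..1} s *\<^sub>R (polylog k (s * z) / s)"
    using AE_lborel_singleton[of 0] by eventually_elim (simp add: K(3))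
  ultimately show ?thesis
    unfolding I(2) using K(1)
    by (subst (asm) has_bochner_integral_cong_AE[where g="\<lambda>s. indicator {0..1} s *\<^sub>R (polylog k (s * z) / s)"]) auto
qed

lemma has_bochner_integral_linear_unit:
  fixes a b :: real
  shows "has_bochner_integral lborel (\<lambda>s. indicator {0..1} s *\<^sub>R (a + b * s)) (a + b / 2)"
proof -
  have "has_bochner_integral lborel (\<lambda>s. (a + b * s) * indicator {0..1} s)
      ((a * 1 + b * 1\<^sup>2 / 2) - (a * 0 + b * 0\<^sup>2 / 2))"
    by (rule has_bochner_integral_FTC_Icc_real) (auto intro!: derivative_eq_intros)
  then show ?thesis by (simp add: mult.commute)
qed

text \<open>The point \<open>s = 0\<close> is left out of the comparison because the integrands below contain a division by \<open>s\<close>,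
which there gives the conventional value 0 instead of the limit.\<close>
lemma has_bochner_integral_mono_unit:
  fixes f g :: "real \<Rightarrow> real"
  assumes "has_bochner_integral lborel (\<lambda>s. indicator {0..1} s *\<^sub>R f s) I"
    and "has_bochner_integral lborel (\<lambda>s. indicator {0..1} s *\<^sub>R g s) J"
    and le: "\<And>s. 0 < s \<Longrightarrow> s \<le> 1 \<Longrightarrow> f s \<le> g s"
  shows "I \<le> J"
proof -
  have "integral\<^sup>L lborel (\<lambda>s. indicator {0..1} s *\<^sub>R f s)
      \<le> integral\<^sup>L lborel (\<lambda>s. indicator {0..1} s *\<^sub>R g s)"
  proof (rule integral_mono_AE)
    show "AE s in lborel. indicator {0..1} s *\<^sub>R f s \<le> indicator {0..1} s *\<^sub>R g s"
      using AE_lborel_singleton[of 0]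
      by eventually_elim (auto split: split_indicator intro: le)
  qed (use assms(1,2) in \<open>auto simp: has_bochner_integral_iff\<close>)
  then show ?thesis using assms(1,2) by (simp add: has_bochner_integral_iff)
qed

text \<open>A quantitative form of \<open>Li\<^sub>k(z) > z\<close> for \<open>z \<noteq> 0\<close>. A lower bound that is explicit in \<open>k\<close> survives
integration as it is, whereas a bare strict inequality would need a separate argument at each step. The
excess is of order \<open>(s * z)\<^sup>2\<close>, so dividing by \<open>s\<close> leaves a factor \<open>s\<close>, whose integral \<open>1 / 2\<close> accounts
for the power of two.\<close>
lemma polylog_ge:
  assumes "z < 1"
  shows "z + z\<^sup>2 / (2 ^ k * (1 + \<bar>z\<bar>)) \<le> polylog k z"
  using assms
proof (induction k arbitrary: z)
  case 0
  have "z\<^sup>2 / (1 + \<bar>z\<bar>) \<le> z\<^sup>2 / (1 - z)"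
    using 0 by (intro divide_left_mono) auto
  also have "\<dots> = z / (1 - z) - z"
    using 0 by (simp add: field_simps power2_eq_square)
  finally show ?case by (simp add: polylog_def)
next
  case (Suc k)
  let ?c = "z\<^sup>2 / (2 ^ k * (1 + \<bar>z\<bar>))"
  have "z + ?c / 2 \<le> polylog (Suc k) z"
  proof (rule has_bochner_integral_mono_unit[OF has_bochner_integral_linear_unit has_bochner_integral_polylog_Suc[OF Suc.prems]])
    fix s :: real
    assume s: "0 < s" "s \<le> 1"
    \<comment> \<open>Enlarging \<open>\<bar>s * z\<bar>\<close> to \<open>\<bar>z\<bar>\<close> in the denominator makes the lower bound linear in \<open>s\<close>
       after the division by \<open>s\<close>.\<close>
    have "s\<^sup>2 * ?c = (s * z)\<^sup>2 / (2 ^ k * (1 + \<bar>z\<bar>))"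
      by (simp add: power_mult_distrib)
    also have "\<dots> \<le> (s * z)\<^sup>2 / (2 ^ k * (1 + \<bar>s * z\<bar>))"
    proof (intro divide_left_mono mult_left_mono add_left_mono)
      show "\<bar>s * z\<bar> \<le> \<bar>z\<bar>"
        using s by (simp add: abs_mult mult_left_le_one_le)
    qed (auto simp: zero_less_mult_iff add_pos_nonneg)
    finally have "s * (z + ?c * s) \<le> s * z + (s * z)\<^sup>2 / (2 ^ k * (1 + \<bar>s * z\<bar>))"
      by (simp add: power2_eq_square algebra_simps)
    also have "\<dots> \<le> polylog k (s * z)"
      by (rule Suc.IH) (use scaled_less_1 Suc.prems s in simp)
    finally show "z + ?c * s \<le> polylog k (s * z) / s"
      using s by (simp add: pos_le_divide_eq mult.commute)
  qed
  moreover have "?c / 2 = z\<^sup>2 / (2 ^ Suc k * (1 + \<bar>z\<bar>))"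
    by (simp only: divide_divide_eq_left power_Suc ac_simps)
  ultimately show ?case by (simp only:)
qed

lemma polylog_ge_self:
  assumes "z < 1"
  shows "z \<le> polylog k z"
  using polylog_ge[OF assms, of k] by (smt (verit) divide_nonneg_nonneg zero_le_power2
      mult_nonneg_nonneg zero_le_power abs_ge_zero)

lemma polylog_eq_self_iff:
  assumes "z < 1"
  shows "polylog k z = z \<longleftrightarrow> z = 0"
proof
  assume "polylog k z = z"
  then have "z\<^sup>2 / (2 ^ k * (1 + \<bar>z\<bar>)) \<le> 0"
    using polylog_ge[OF assms, of k] by simp
  then show "z = 0"
    by (smt (verit) divide_pos_pos zero_less_power2 mult_pos_pos zero_less_power)
qed simp

text \<open>\<open>Li\<^sub>0(z) = 1 / (1 - z) - 1\<close> is convex, and \<open>Li\<^sub>k\<^sub>+\<^sub>1\<close> is a positive superposition of the dilations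
\<open>z \<mapsto> Li\<^sub>k(s * z)\<close>.\<close>
lemma convex_on_polylog: "convex_on {..<1} (polylog k)"
proof (induction k)
  case 0
  have "convex_on {..<1} (\<lambda>z::real. z / (1 - z))"
  proof (rule convex_on_realI[where f' = "\<lambda>z. 1 / (1 - z)\<^sup>2"])
    fix z :: real
    assume "z \<in> {..<1}"
    then show "((\<lambda>z. z / (1 - z)) has_real_derivative 1 / (1 - z)\<^sup>2) (at z)"
      by (auto intro!: derivative_eq_intros simp: field_simps power2_eq_square)
  next
    fix x y :: real
    assume "x \<in> {..<1}" "y \<in> {..<1}" "x \<le> y"
    then show "1 / (1 - x)\<^sup>2 \<le> 1 / (1 - y)\<^sup>2"
      by (intro divide_left_mono power_mono) (auto simp: zero_less_mult_iff)
  qed (simp add: connected_iff_interval)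
  then show ?case by (simp add: polylog_def[abs_def])
next
  case (Suc k)
  show ?case
  proof (rule convex_onI)
    fix l x y :: real
    assume l: "0 < l" "l < 1" and xy: "x \<in> {..<1}" "y \<in> {..<1}"
    let ?m = "(1 - l) *\<^sub>R x + l *\<^sub>R y"
    have m: "?m < 1"
      using convexD_alt[OF convex_real_interval(4), of x 1 y l] l xy by simp
    have "has_bochner_integral lborel
        (\<lambda>s. (1 - l) * (indicator {0..1} s *\<^sub>R (polylog k (s * x) / s))
             + l * (indicator {0..1} s *\<^sub>R (polylog k (s * y) / s)))
        ((1 - l) * polylog (Suc k) x + l * polylog (Suc k) y)"
      using xy by (intro has_bochner_integral_add has_bochner_integral_mult_right
          has_bochner_integral_polylog_Suc) auto
    moreover have "(\<lambda>s. (1 - l) * (indicator {0..1} s *\<^sub>R (polylog k (s * x) / s))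
             + l * (indicator {0..1} s *\<^sub>R (polylog k (s * y) / s)))
        = (\<lambda>s. indicator {0..1} s *\<^sub>R (((1 - l) * polylog k (s * x) + l * polylog k (s * y)) / s))"
      by (auto simp: fun_eq_iff add_divide_distrib split: split_indicator)
    ultimately have "has_bochner_integral lborel
        (\<lambda>s. indicator {0..1} s *\<^sub>R (((1 - l) * polylog k (s * x) + l * polylog k (s * y)) / s))
        ((1 - l) * polylog (Suc k) x + l * polylog (Suc k) y)"
      by (simp only:)
    then show "polylog (Suc k) ?m \<le> (1 - l) * polylog (Suc k) x + l * polylog (Suc k) y"
    proof (rule has_bochner_integral_mono_unit[OF has_bochner_integral_polylog_Suc[OF m]])
      fix s :: real
      assume s: "0 < s" "s \<le> 1"
      have "polylog k ((1 - l) *\<^sub>R (s * x) + l *\<^sub>R (s * y))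
          \<le> (1 - l) * polylog k (s * x) + l * polylog k (s * y)"
        using l s xy scaled_less_1 by (intro convex_onD[OF Suc.IH]) auto
      moreover have "(1 - l) *\<^sub>R (s * x) + l *\<^sub>R (s * y) = s * ?m"
        by (simp add: algebra_simps)
      ultimately show "polylog k (s * ?m) / s
          \<le> ((1 - l) * polylog k (s * x) + l * polylog k (s * y)) / s"
        using s by (simp add: divide_right_mono)
    qed
  qed simp
qed

text \<open>Convexity together with \<open>Li\<^sub>k(0) = 0\<close> gives \<open>Li\<^sub>k(s * z) / s \<le> Li\<^sub>k(z)\<close>, so the average over \<open>s\<close> is at
most \<open>Li\<^sub>k(z)\<close>. This covers negative arguments, where the power series does not show it.\<close>
lemma polylog_Suc_le:
  assumes z: "z < 1"
  shows "polylog (Suc k) z \<le> polylog k z"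
proof -
  have "has_bochner_integral lborel (\<lambda>s::real. indicator {0..1} s *\<^sub>R polylog k z) (polylog k z)"
    using has_bochner_integral_linear_unit[of "polylog k z" 0] by simp
  then show ?thesis
  proof (rule has_bochner_integral_mono_unit[OF has_bochner_integral_polylog_Suc[OF z]])
    fix s :: real
    assume s: "0 < s" "s \<le> 1"
    have "polylog k ((1 - s) *\<^sub>R 0 + s *\<^sub>R z) \<le> (1 - s) * polylog k 0 + s * polylog k z"
      using s z by (intro convex_onD[OF convex_on_polylog]) auto
    then show "polylog k (s * z) / s \<le> polylog k z"
      using s by (simp add: pos_divide_le_eq mult.commute)
  qed
qed

section \<open>Averaging under an integral\<close>

text \<open>The integrand \<open>polylog k (s * u x) / s\<close> changes sign with \<open>u\<close>, and no absolute bound for it is at hand.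
Subtracting \<open>u x\<close> makes it nonnegative for \<open>0 < s \<le> 1\<close>, by \<open>polylog_ge_self\<close>, so that integrability over the product
already follows from integrability of the single function \<open>polylog (Suc k) (u x)\<close>; since \<open>u\<close> has mean
zero, the subtraction does not change the integrals.\<close>
lemma
  fixes u :: "'a \<Rightarrow> real"
  assumes M: "sigma_finite_measure M"
    and u_lt: "\<And>x. u x < 1"
    and u_int: "integrable M u" and u_zero: "(\<integral>x. u x \<partial>M) = 0"
    and int_Suc: "integrable M (\<lambda>x. polylog (Suc k) (u x))"
    and int_k: "\<And>s. 0 < s \<Longrightarrow> s \<le> 1 \<Longrightarrow> integrable M (\<lambda>x. polylog k (s * u x))"
  shows set_integrable_integral_polylog:
      "set_integrable lborel {0..1} (\<lambda>s. 1 / s * (\<integral>x. polylog k (s * u x) \<partial>M))"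
    and integral_polylog_Suc:
      "(LINT s:{0..1}|lborel. 1 / s * (\<integral>x. polylog k (s * u x) \<partial>M))
         = (\<integral>x. polylog (Suc k) (u x) \<partial>M)"
proof -
  interpret pair_sigma_finite M lborel
    using M by (intro pair_sigma_finite.intro sigma_finite_lborel)
  have [measurable]: "u \<in> borel_measurable M" using u_int by simp
  define h where "h x s = indicator {0..1} s *\<^sub>R (polylog k (s * u x) / s)
      - indicator {0..1} s *\<^sub>R u x" for x and s :: real
  have h_meas: "case_prod h \<in> borel_measurable (M \<Otimes>\<^sub>M lborel)"
    unfolding h_def by measurable
  have h_int: "has_bochner_integral lborel (h x) (polylog (Suc k) (u x) - u x)" for x
  proof -
    have "has_bochner_integral lborel (\<lambda>s::real. indicator {0..1} s *\<^sub>R u x) (u x)"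
      using has_bochner_integral_linear_unit[of "u x" 0] by simp
    then show ?thesis
      unfolding h_def[abs_def]
      by (intro has_bochner_integral_diff has_bochner_integral_polylog_Suc u_lt)
  qed
  have h_norm: "(\<integral>s. norm (h x s) \<partial>lborel) = polylog (Suc k) (u x) - u x" for x
  proof -
    have "AE s in lborel. norm (h x s) = h x s"
      using AE_lborel_singleton[of 0]
    proof eventually_elim
      fix s :: real
      assume "s \<noteq> 0"
      moreover have "s * u x \<le> polylog k (s * u x)" if "s \<in> {0..1}"
        using that u_lt scaled_less_1 by (intro polylog_ge_self) auto
      ultimately show "norm (h x s) = h x s"
        by (auto simp: h_def pos_le_divide_eq mult.commute split: split_indicator)
    qed
    then have "(\<integral>s. norm (h x s) \<partial>lborel) = (\<integral>s. h x s \<partial>lborel)"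
      using h_int[of x] by (intro integral_cong_AE) (auto simp: has_bochner_integral_iff)
    then show ?thesis
      using h_int[of x] by (simp add: has_bochner_integral_iff)
  qed
  have h_prod: "integrable (M \<Otimes>\<^sub>M lborel) (case_prod h)"
  proof (rule Fubini_integrable[OF h_meas])
    show "integrable M (\<lambda>x. \<integral>s. norm (case (x, s) of (x, s) \<Rightarrow> h x s) \<partial>lborel)"
      using int_Suc u_int by (simp add: h_norm[unfolded real_norm_def])
    show "AE x in M. integrable lborel (\<lambda>s. case (x, s) of (x, s) \<Rightarrow> h x s)"
      using h_int by (simp add: has_bochner_integral_iff)
  qed
  have inner: "AE s in lborel. (\<integral>x. h x s \<partial>M)
      = indicator {0..1} s *\<^sub>R (1 / s * (\<integral>x. polylog k (s * u x) \<partial>M))"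
    using AE_lborel_singleton[of 0]
  proof eventually_elim
    fix s :: real
    assume "s \<noteq> 0"
    then show "(\<integral>x. h x s \<partial>M)
        = indicator {0..1} s *\<^sub>R (1 / s * (\<integral>x. polylog k (s * u x) \<partial>M))"
      using int_k[of s] u_int u_zero by (auto simp: h_def split: split_indicator)
  qed
  have outer_meas: "(\<lambda>s. indicator {0..1} s *\<^sub>R (1 / s * (\<integral>x. polylog k (s * u x) \<partial>M)))
      \<in> borel_measurable lborel"
    by measurable
  show "set_integrable lborel {0..1} (\<lambda>s. 1 / s * (\<integral>x. polylog k (s * u x) \<partial>M))"
    unfolding set_integrable_def
    using integrable_cong_AE_imp[OF integrable_snd[OF h_prod] outer_meas] inner
    by (simp add: eq_commute)
  have "(LINT s:{0..1}|lborel. 1 / s * (\<integral>x. polylog k (s * u x) \<partial>M))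
      = (\<integral>s. (\<integral>x. h x s \<partial>M) \<partial>lborel)"
    unfolding set_lebesgue_integral_def
    using integrable_snd[OF h_prod] outer_meas inner
    by (intro integral_cong_AE) (auto simp: eq_commute)
  also have "\<dots> = (\<integral>x. (\<integral>s. h x s \<partial>lborel) \<partial>M)"
    by (rule Fubini_integral[OF h_prod])
  also have "\<dots> = (\<integral>x. polylog (Suc k) (u x) \<partial>M)"
    using h_int int_Suc u_int u_zero by (simp add: has_bochner_integral_iff)
  finally show "(LINT s:{0..1}|lborel. 1 / s * (\<integral>x. polylog k (s * u x) \<partial>M))
      = (\<integral>x. polylog (Suc k) (u x) \<partial>M)" .
qed

section \<open>Densities of the members of a mixture family\<close>

text \<open>The argument \<open>1 - q / p\<close> of the polylogarithm. The value 0 off the joint support keeps it below 1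
everywhere, and since the polylogarithm vanishes at 0 the integral over the joint support becomes an
integral over the whole space.\<close>
definition deficit :: "'a measure \<Rightarrow> 'a measure \<Rightarrow> 'a measure \<Rightarrow> 'a \<Rightarrow> real" where
  "deficit \<mu> P Q x =
     (if 0 < dens \<mu> P x \<and> 0 < dens \<mu> Q x then 1 - dens \<mu> Q x / dens \<mu> P x else 0)"

lemma borel_measurable_dens [measurable]: "dens \<mu> P \<in> borel_measurable \<mu>"
  unfolding dens_def[abs_def] by measurable

lemma dens_nonneg: "0 \<le> dens \<mu> P x"
  by (simp add: dens_def)

lemma borel_measurable_deficit [measurable]: "deficit \<mu> P Q \<in> borel_measurable \<mu>"
  unfolding deficit_def[abs_def] by measurable

lemma deficit_less_1: "deficit \<mu> P Q x < 1"
  by (simp add: deficit_def)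

lemma deficit_self: "deficit \<mu> P P x = 0"
  by (simp add: deficit_def)

locale mixture_family =
  fixes \<mu> :: "'a measure" and \<P> :: "'a measure set"
  assumes prob: "\<And>P. P \<in> \<P> \<Longrightarrow> prob_space P"
    and sets_eq: "\<And>P. P \<in> \<P> \<Longrightarrow> sets P = sets \<mu>"
    and has_dens: "\<And>P. P \<in> \<P> \<Longrightarrow> has_dens \<mu> P"
    and support: "common_support \<mu> \<P>"
    and mixture_closed:
      "\<And>P Q t. P \<in> \<P> \<Longrightarrow> Q \<in> \<P> \<Longrightarrow> t \<in> {0..1} \<Longrightarrow> mixture t P Q \<in> \<P>"
begin

text \<open>Passing from the extended to the real-valued derivative loses nothing, because a probability density is
finite almost everywhere. With this, integrals against the reference measure, which may fail to be
sigma-finite, can be rewritten as integrals against the finite measure \<open>P\<close>.\<close>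
lemma density_dens:
  assumes P: "P \<in> \<P>"
  shows "density \<mu> (\<lambda>x. ennreal (dens \<mu> P x)) = P"
proof -
  interpret prob_space P using P by (rule prob)
  have RN: "density \<mu> (RN_deriv \<mu> P) = P"
    using has_dens[OF P] unfolding has_dens_def by (auto intro: RN_derivI)
  have "(\<integral>\<^sup>+x. RN_deriv \<mu> P x \<partial>\<mu>) = emeasure (density \<mu> (RN_deriv \<mu> P)) (space \<mu>)"
    by (subst emeasure_density) (auto intro!: nn_integral_cong)
  also have "\<dots> = 1"
    unfolding RN using emeasure_space_1 sets_eq_imp_space_eq[OF sets_eq[OF P]] by simp
  finally have "AE x in \<mu>. RN_deriv \<mu> P x \<noteq> \<infinity>"
    by (intro nn_integral_noteq_infinite) auto
  then have "density \<mu> (\<lambda>x. ennreal (dens \<mu> P x)) = density \<mu> (RN_deriv \<mu> P)"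
    by (intro density_cong) (auto simp: dens_def ennreal_enn2real_if)
  then show ?thesis using RN by simp
qed

lemma emeasure_eq_dens:
  assumes "P \<in> \<P>" "A \<in> sets \<mu>"
  shows "emeasure P A = (\<integral>\<^sup>+x. ennreal (dens \<mu> P x) * indicator A x \<partial>\<mu>)"
  using emeasure_density[of "\<lambda>x. ennreal (dens \<mu> P x)" \<mu> A] assms density_dens by simp

lemma AE_member:
  assumes P: "P \<in> \<P>"
  shows "(AE x in P. \<phi> x) \<longleftrightarrow> (AE x in \<mu>. 0 < dens \<mu> P x \<longrightarrow> \<phi> x)"
  by (subst density_dens[OF P, symmetric], subst AE_density) auto

lemma integrable_member_iff:
  fixes f :: "'a \<Rightarrow> real"
  assumes P: "P \<in> \<P>" and f: "f \<in> borel_measurable \<mu>"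
  shows "integrable P f \<longleftrightarrow> integrable \<mu> (\<lambda>x. dens \<mu> P x * f x)"
  using integrable_density[OF f, of "dens \<mu> P"] density_dens[OF P] by (simp add: dens_nonneg)

lemma integral_member_eq:
  fixes f :: "'a \<Rightarrow> real"
  assumes P: "P \<in> \<P>" and f: "f \<in> borel_measurable \<mu>"
  shows "(\<integral>x. f x \<partial>P) = (\<integral>x. dens \<mu> P x * f x \<partial>\<mu>)"
  using integral_density[OF f, of "dens \<mu> P"] density_dens[OF P] by (simp add: dens_nonneg)

lemma
  assumes P: "P \<in> \<P>"
  shows integrable_dens: "integrable \<mu> (dens \<mu> P)"
    and integral_dens: "(\<integral>x. dens \<mu> P x \<partial>\<mu>) = 1"
proof -
  interpret prob_space P using P by (rule prob)
  show "integrable \<mu> (dens \<mu> P)"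
    using integrable_member_iff[OF P, of "\<lambda>_. 1"] by simp
  show "(\<integral>x. dens \<mu> P x \<partial>\<mu>) = 1"
    using integral_member_eq[OF P, of "\<lambda>_. 1"] prob_space by simp
qed

text \<open>The uniqueness of densities is taken from the finiteness of the total mass, since \<open>\<mu>\<close>
need not be sigma-finite.\<close>
lemma dens_mixture:
  assumes P: "P \<in> \<P>" and Q: "Q \<in> \<P>" and t: "t \<in> {0..1}"
  shows "AE x in \<mu>. dens \<mu> (mixture t P Q) x = (1 - t) * dens \<mu> P x + t * dens \<mu> Q x"
proof -
  let ?R = "mixture t P Q" and ?r = "\<lambda>x. (1 - t) * dens \<mu> P x + t * dens \<mu> Q x"
  have R: "?R \<in> \<P>" using assms by (rule mixture_closed)
  have r_nonneg: "0 \<le> ?r x" for x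
    using t by (simp add: dens_nonneg)
  have "density \<mu> (\<lambda>x. ennreal (?r x)) = ?R"
  proof (rule measure_eqI)
    fix A
    assume "A \<in> sets (density \<mu> (\<lambda>x. ennreal (?r x)))"
    then have A: "A \<in> sets \<mu>" by simp
    have "ennreal (?r x) * indicator A x = ennreal (1 - t) * (ennreal (dens \<mu> P x) * indicator A x)
        + ennreal t * (ennreal (dens \<mu> Q x) * indicator A x)" for x
      using t by (auto split: split_indicator simp: ennreal_mult'[symmetric] dens_nonneg
          simp flip: ennreal_plus)
    then have "emeasure (density \<mu> (\<lambda>x. ennreal (?r x))) A
        = ennreal (1 - t) * emeasure P A + ennreal t * emeasure Q A"
      using A by (simp add: emeasure_density emeasure_eq_dens P Q nn_integral_add nn_integral_cmult)
    also have "\<dots> = emeasure ?R A"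
      using A sets_eq P Q by (simp add: emeasure_mixture)
    finally show "emeasure (density \<mu> (\<lambda>x. ennreal (?r x))) A = emeasure ?R A" .
  qed (simp add: sets_eq[OF P])
  then have "density \<mu> (\<lambda>x. ennreal (dens \<mu> ?R x)) = density \<mu> (\<lambda>x. ennreal (?r x))"
    using density_dens[OF R] by simp
  moreover have "(\<integral>\<^sup>+x. ennreal (dens \<mu> ?R x) \<partial>\<mu>) \<noteq> \<infinity>"
    using integrable_dens[OF R] by (simp add: nn_integral_eq_integral dens_nonneg)
  ultimately have "AE x in \<mu>. ennreal (dens \<mu> ?R x) = ennreal (?r x)"
    by (subst (asm) finite_density_unique) auto
  then show ?thesis
    by (rule AE_mp) (simp add: dens_nonneg r_nonneg)
qed

lemma AE_dens_pos_iff: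
  assumes "P \<in> \<P>" "Q \<in> \<P>"
  shows "AE x in \<mu>. 0 < dens \<mu> P x \<longleftrightarrow> 0 < dens \<mu> Q x"
proof -
  obtain S where S: "\<And>P. P \<in> \<P> \<Longrightarrow> AE x in \<mu>. x \<in> S \<longleftrightarrow> 0 < dens \<mu> P x"
    using support unfolding common_support_def by blast
  from S[OF assms(1)] S[OF assms(2)] show ?thesis by eventually_elim blast
qed

lemma dens_mult_deficit:
  assumes "P \<in> \<P>" "Q \<in> \<P>"
  shows "AE x in \<mu>. dens \<mu> P x * deficit \<mu> P Q x = dens \<mu> P x - dens \<mu> Q x"
  using AE_dens_pos_iff[OF assms]
proof eventually_elim
  fix x
  assume "0 < dens \<mu> P x \<longleftrightarrow> 0 < dens \<mu> Q x"
  then show "dens \<mu> P x * deficit \<mu> P Q x = dens \<mu> P x - dens \<mu> Q x"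
    using dens_nonneg[of \<mu> P x] dens_nonneg[of \<mu> Q x]
    by (auto simp: deficit_def right_diff_distrib)
qed

text \<open>The mean under \<open>P\<close> is \<open>\<integral> (p - q) d\<mu> = 1 - 1\<close>. The common support enters here: without it the mass that
\<open>Q\<close> puts outside the support of \<open>P\<close> would be missed.\<close>
lemma
  assumes P: "P \<in> \<P>" and Q: "Q \<in> \<P>"
  shows integrable_deficit: "integrable P (deficit \<mu> P Q)"
    and integral_deficit: "(\<integral>x. deficit \<mu> P Q x \<partial>P) = 0"
proof -
  have diff: "integrable \<mu> (\<lambda>x. dens \<mu> P x - dens \<mu> Q x)"
    using integrable_dens P Q by auto
  show "integrable P (deficit \<mu> P Q)"
    unfolding integrable_member_iff[OF P borel_measurable_deficit]
    using dens_mult_deficit[OF P Q]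
    by (intro integrable_cong_AE_imp[OF diff]) (auto simp: eq_commute)
  have "(\<integral>x. deficit \<mu> P Q x \<partial>P) = (\<integral>x. dens \<mu> P x - dens \<mu> Q x \<partial>\<mu>)"
    unfolding integral_member_eq[OF P borel_measurable_deficit]
    using dens_mult_deficit[OF P Q] by (intro integral_cong_AE) auto
  then show "(\<integral>x. deficit \<mu> P Q x \<partial>P) = 0"
    using integrable_dens integral_dens P Q by simp
qed

text \<open>The deficit is affine in its second argument. This carries the convexity of the polylogarithm over to
right-convexity, and for \<open>Q2 = P\<close> it shows that along the segment from \<open>P\<close> to \<open>Q1\<close> the deficit is
scaled by the parameter.\<close>
lemma deficit_mixture:
  assumes P: "P \<in> \<P>" and Q1: "Q1 \<in> \<P>" and Q2: "Q2 \<in> \<P>" and l: "l \<in> {0..1}"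
  shows "AE x in P. deficit \<mu> P (mixture l Q2 Q1) x
           = (1 - l) * deficit \<mu> P Q2 x + l * deficit \<mu> P Q1 x"
  unfolding AE_member[OF P]
  using dens_mixture[OF Q2 Q1 l] AE_dens_pos_iff[OF P Q1] AE_dens_pos_iff[OF P Q2]
    AE_dens_pos_iff[OF P mixture_closed[OF Q2 Q1 l]]
proof eventually_elim
  fix x
  assume "dens \<mu> (mixture l Q2 Q1) x = (1 - l) * dens \<mu> Q2 x + l * dens \<mu> Q1 x"
    "0 < dens \<mu> P x \<longleftrightarrow> 0 < dens \<mu> Q1 x" "0 < dens \<mu> P x \<longleftrightarrow> 0 < dens \<mu> Q2 x"
    "0 < dens \<mu> P x \<longleftrightarrow> 0 < dens \<mu> (mixture l Q2 Q1) x"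
  then show "0 < dens \<mu> P x \<longrightarrow> deficit \<mu> P (mixture l Q2 Q1) x
      = (1 - l) * deficit \<mu> P Q2 x + l * deficit \<mu> P Q1 x"
    by (auto simp: deficit_def field_simps)
qed

lemma eq_if_deficit_AE_zero:
  assumes P: "P \<in> \<P>" and Q: "Q \<in> \<P>" and zero: "AE x in P. deficit \<mu> P Q x = 0"
  shows "P = Q"
proof -
  have "AE x in \<mu>. dens \<mu> P x = dens \<mu> Q x"
    using dens_mult_deficit[OF P Q] zero[unfolded AE_member[OF P]]
  proof eventually_elim
    fix x
    assume "dens \<mu> P x * deficit \<mu> P Q x = dens \<mu> P x - dens \<mu> Q x"
      "0 < dens \<mu> P x \<longrightarrow> deficit \<mu> P Q x = 0"
    then show "dens \<mu> P x = dens \<mu> Q x"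
      using dens_nonneg[of \<mu> P x] by (cases "0 < dens \<mu> P x") auto
  qed
  then have "density \<mu> (\<lambda>x. ennreal (dens \<mu> P x)) = density \<mu> (\<lambda>x. ennreal (dens \<mu> Q x))"
    by (intro density_cong) auto
  then show ?thesis using density_dens P Q by simp
qed

lemma borel_measurable_polylog_deficit:
  assumes "P \<in> \<P>"
  shows "(\<lambda>x. polylog k (s * deficit \<mu> P' Q x)) \<in> borel_measurable P"
  unfolding measurable_cong_sets[OF sets_eq[OF assms] refl] by measurable

lemma PL_eq:
  assumes P: "P \<in> \<P>"
  shows "PL \<mu> k P Q = (\<integral>x. polylog k (deficit \<mu> P Q x) \<partial>P)"
proof -
  have "(\<integral>x. polylog k (deficit \<mu> P Q x) \<partial>P)
      = (\<integral>x. dens \<mu> P x * polylog k (deficit \<mu> P Q x) \<partial>\<mu>)"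
    by (rule integral_member_eq[OF P]) measurable
  also have "\<dots> = PL \<mu> k P Q"
    unfolding PL_def set_lebesgue_integral_def
    by (intro Bochner_Integration.integral_cong refl)
      (auto simp: PL_integrand_def supp2_def deficit_def split: split_indicator)
  finally show ?thesis ..
qed

end

section \<open>Polylogarithmic divergences\<close>

locale polylog_family = mixture_family +
  assumes PL_finite: "\<And>k P Q. P \<in> \<P> \<Longrightarrow> Q \<in> \<P> \<Longrightarrow>
           set_integrable \<mu> (supp2 \<mu> P Q) (PL_integrand \<mu> k P Q)"
begin

lemma integrable_polylog_deficit:
  assumes P: "P \<in> \<P>" and Q: "Q \<in> \<P>"
  shows "integrable P (\<lambda>x. polylog k (deficit \<mu> P Q x))"
proof -
  have "integrable \<mu> (\<lambda>x. dens \<mu> P x * polylog k (deficit \<mu> P Q x))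
      \<longleftrightarrow> set_integrable \<mu> (supp2 \<mu> P Q) (PL_integrand \<mu> k P Q)"
    unfolding set_integrable_def
    by (intro Bochner_Integration.integrable_cong refl)
      (auto simp: PL_integrand_def supp2_def deficit_def split: split_indicator)
  then show ?thesis
    using PL_finite[OF P Q] by (subst integrable_member_iff[OF P]) auto
qed

lemma deficit_segment:
  assumes P: "P \<in> \<P>" and Q: "Q \<in> \<P>" and s: "s \<in> {0..1}"
  shows "AE x in P. polylog k (deficit \<mu> P (mixture s P Q) x) = polylog k (s * deficit \<mu> P Q x)"
  using deficit_mixture[OF P Q P s] by eventually_elim (simp add: deficit_self)

lemma integrable_polylog_segment:
  assumes P: "P \<in> \<P>" and Q: "Q \<in> \<P>" and s: "s \<in> {0..1}"
  shows "integrable P (\<lambda>x. polylog k (s * deficit \<mu> P Q x))"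
  by (rule integrable_cong_AE_imp[OF integrable_polylog_deficit[OF P mixture_closed[OF P Q s], of k]
        borel_measurable_polylog_deficit[OF P]])
    (use deficit_segment[OF P Q s] in \<open>simp add: eq_commute\<close>)

lemma PL_segment:
  assumes P: "P \<in> \<P>" and Q: "Q \<in> \<P>" and s: "s \<in> {0..1}"
  shows "PL \<mu> k P (mixture s P Q) = (\<integral>x. polylog k (s * deficit \<mu> P Q x) \<partial>P)"
  unfolding PL_eq[OF P]
  using deficit_segment[OF P Q s] borel_measurable_polylog_deficit[OF P]
    integrable_polylog_deficit[OF P mixture_closed[OF P Q s]]
  by (intro integral_cong_AE) auto

text \<open>By \<open>PL_segment\<close> the operator averages \<open>polylog k (s * u) / s\<close> over \<open>s\<close> for the deficit \<open>u\<close>, which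
raises the order of the polylogarithm by one.\<close>
lemma Psi_PL:
  assumes P: "P \<in> \<P>" and Q: "Q \<in> \<P>"
  shows "set_integrable lborel {0..1} (\<lambda>s. 1 / s * PL \<mu> k P (mixture s P Q))"
    and "Psi (PL \<mu> k) P Q = PL \<mu> (Suc k) P Q"
proof -
  interpret prob_space P using P by (rule prob)
  note hyps = sigma_finite_measure_axioms deficit_less_1
    integrable_deficit[OF P Q] integral_deficit[OF P Q] integrable_polylog_deficit[OF P Q]
    integrable_polylog_segment[OF P Q]
  have "set_integrable lborel {0..1} (\<lambda>s. 1 / s * (\<integral>x. polylog k (s * deficit \<mu> P Q x) \<partial>P))"
    by (rule set_integrable_integral_polylog) (use hyps in auto)
  then show "set_integrable lborel {0..1} (\<lambda>s. 1 / s * PL \<mu> k P (mixture s P Q))"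
    by (rule set_integrable_cong[THEN iffD1, rotated -1]) (auto simp: PL_segment[OF P Q])
  have "Psi (PL \<mu> k) P Q
      = (LINT s:{0..1}|lborel. 1 / s * (\<integral>x. polylog k (s * deficit \<mu> P Q x) \<partial>P))"
    unfolding Psi_def by (intro set_lebesgue_integral_cong) (auto simp: PL_segment[OF P Q])
  also have "\<dots> = PL \<mu> (Suc k) P Q"
    unfolding PL_eq[OF P] by (rule integral_polylog_Suc) (use hyps in auto)
  finally show "Psi (PL \<mu> k) P Q = PL \<mu> (Suc k) P Q" .
qed

text \<open>The induction runs over all pairs at once, since an application of the operator evaluates its argument at
every mixture on the segment.\<close>
lemma PL_eq_Psi_iterate:
  assumes "P \<in> \<P>" "Q \<in> \<P>"
  shows "(Psi ^^ k) (PL \<mu> 0) P Q = PL \<mu> k P Q"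
  using assms
proof (induction k arbitrary: P Q)
  case (Suc k)
  have "(Psi ^^ Suc k) (PL \<mu> 0) P Q = Psi (PL \<mu> k) P Q"
    unfolding funpow.simps comp_apply Psi_def[of "(Psi ^^ k) (PL \<mu> 0)"] Psi_def[of "PL \<mu> k"]
    using Suc mixture_closed by (intro set_lebesgue_integral_cong) auto
  then show ?case using Psi_PL(2)[OF Suc.prems] by simp
qed simp

lemma Psi_defined_on_iterate: "Psi_defined_on \<P> ((Psi ^^ k) (PL \<mu> 0))"
  unfolding Psi_defined_on_def
proof (intro ballI)
  fix P Q
  assume P: "P \<in> \<P>" and Q: "Q \<in> \<P>"
  show "set_integrable lborel {0..1} (\<lambda>s. 1 / s * (Psi ^^ k) (PL \<mu> 0) P (mixture s P Q))"
    using Psi_PL(1)[OF P Q, of k]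
    by (rule set_integrable_cong[THEN iffD1, rotated -1])
      (auto simp: PL_eq_Psi_iterate P Q mixture_closed)
qed

text \<open>As the deficit has mean zero, the divergence is also the integral of the excess \<open>Li\<^sub>k(u) - u \<ge> 0\<close>, which
vanishes only at \<open>u = 0\<close>.\<close>
lemma PL_nonneg_and_eq_0_iff:
  assumes P: "P \<in> \<P>" and Q: "Q \<in> \<P>"
  shows "0 \<le> PL \<mu> k P Q \<and> (PL \<mu> k P Q = 0 \<longleftrightarrow> P = Q)"
proof -
  let ?d = "deficit \<mu> P Q" and ?g = "\<lambda>x. polylog k (deficit \<mu> P Q x) - deficit \<mu> P Q x"
  have g_int: "integrable P ?g"
    using integrable_polylog_deficit[OF P Q] integrable_deficit[OF P Q] by auto
  have PL_g: "PL \<mu> k P Q = (\<integral>x. ?g x \<partial>P)"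
    using integrable_polylog_deficit[OF P Q] integrable_deficit[OF P Q] integral_deficit[OF P Q]
    by (simp add: PL_eq[OF P])
  have g_nonneg: "0 \<le> ?g x" for x
    using polylog_ge_self[OF deficit_less_1] by simp
  have "PL \<mu> k P Q = 0 \<longleftrightarrow> (AE x in P. ?g x = 0)"
    unfolding PL_g using g_nonneg by (intro integral_nonneg_eq_0_iff_AE[OF g_int]) simp
  also have "\<dots> \<longleftrightarrow> (AE x in P. ?d x = 0)"
    by (simp add: polylog_eq_self_iff deficit_less_1)
  also have "\<dots> \<longleftrightarrow> P = Q"
    using eq_if_deficit_AE_zero[OF P Q] deficit_self[of \<mu> P] by auto
  finally show ?thesis
    unfolding PL_g using g_nonneg by (auto intro: integral_nonneg_AE)
qed

lemma divergence_on_PL: "divergence_on \<P> (\<lambda>P Q. ereal (PL \<mu> k P Q))"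
  unfolding divergence_on_def using PL_nonneg_and_eq_0_iff by auto

lemma PL_right_convex:
  assumes P: "P \<in> \<P>" and Q1: "Q1 \<in> \<P>" and Q2: "Q2 \<in> \<P>" and l: "l \<in> {0..1}"
  shows "PL \<mu> k P (mixture l Q2 Q1) \<le> l * PL \<mu> k P Q1 + (1 - l) * PL \<mu> k P Q2"
proof -
  note int = integrable_polylog_deficit[OF P]
  have "PL \<mu> k P (mixture l Q2 Q1)
      \<le> (\<integral>x. l * polylog k (deficit \<mu> P Q1 x) + (1 - l) * polylog k (deficit \<mu> P Q2 x) \<partial>P)"
    unfolding PL_eq[OF P]
  proof (rule integral_mono_AE)
    show "AE x in P. polylog k (deficit \<mu> P (mixture l Q2 Q1) x)
        \<le> l * polylog k (deficit \<mu> P Q1 x) + (1 - l) * polylog k (deficit \<mu> P Q2 x)"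
      using deficit_mixture[OF P Q1 Q2 l]
    proof eventually_elim
      fix x
      assume "deficit \<mu> P (mixture l Q2 Q1) x
          = (1 - l) * deficit \<mu> P Q2 x + l * deficit \<mu> P Q1 x"
      then show "polylog k (deficit \<mu> P (mixture l Q2 Q1) x)
          \<le> l * polylog k (deficit \<mu> P Q1 x) + (1 - l) * polylog k (deficit \<mu> P Q2 x)"
        using convex_onD[OF convex_on_polylog, of l "deficit \<mu> P Q2 x" "deficit \<mu> P Q1 x" k] l
        by (simp add: deficit_less_1 add.commute)
    qed
  qed (use int Q1 Q2 mixture_closed[OF Q2 Q1 l] in auto)
  also have "\<dots> = l * PL \<mu> k P Q1 + (1 - l) * PL \<mu> k P Q2"
    using int Q1 Q2 by (simp add: PL_eq[OF P])
  finally show ?thesis .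
qed

lemma right_convex_on_PL: "right_convex_on \<P> (\<lambda>P Q. ereal (PL \<mu> k P Q))"
  unfolding right_convex_on_def using PL_right_convex by auto

lemma decseq_PL:
  assumes P: "P \<in> \<P>" and Q: "Q \<in> \<P>"
  shows "decseq (\<lambda>k. PL \<mu> k P Q)"
proof (rule decseq_SucI)
  fix k
  show "PL \<mu> (Suc k) P Q \<le> PL \<mu> k P Q"
    unfolding PL_eq[OF P]
    by (intro integral_mono integrable_polylog_deficit P Q polylog_Suc_le deficit_less_1)
qed

end

theorem proposition1:
  fixes \<mu> :: "'a measure" and \<P> :: "'a measure set"
  assumes "\<And>P. P \<in> \<P> \<Longrightarrow> prob_space P"
    and "\<And>P. P \<in> \<P> \<Longrightarrow> sets P = sets \<mu>"
    and "\<And>P. P \<in> \<P> \<Longrightarrow> has_dens \<mu> P"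
    and "common_support \<mu> \<P>"
    and "\<And>P Q t. P \<in> \<P> \<Longrightarrow> Q \<in> \<P> \<Longrightarrow> t \<in> {0..1} \<Longrightarrow> mixture t P Q \<in> \<P>"
    and "\<And>k P Q. P \<in> \<P> \<Longrightarrow> Q \<in> \<P> \<Longrightarrow>
           set_integrable \<mu> (supp2 \<mu> P Q) (PL_integrand \<mu> k P Q)"
  shows "(\<forall>k. Psi_defined_on \<P> ((Psi ^^ k) (PL \<mu> 0))) \<and>
    (\<forall>k. \<forall>P \<in> \<P>. \<forall>Q \<in> \<P>. \<forall>t \<in> {0..1}.
       PL \<mu> k P (mixture t P Q) = (Psi ^^ k) (PL \<mu> 0) P (mixture t P Q)) \<and>
    (\<forall>k. divergence_on \<P> (\<lambda>P Q. ereal (PL \<mu> k P Q)) \<and>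
         right_convex_on \<P> (\<lambda>P Q. ereal (PL \<mu> k P Q))) \<and>
    (\<forall>P \<in> \<P>. \<forall>Q \<in> \<P>. \<forall>t \<in> {0..1}. decseq (\<lambda>k. PL \<mu> k P (mixture t P Q)))"
proof -
  interpret polylog_family \<mu> \<P>
    by (intro polylog_family.intro mixture_family.intro polylog_family_axioms.intro)
      (fact assms)+
  show ?thesis
    using Psi_defined_on_iterate PL_eq_Psi_iterate mixture_closed divergence_on_PL
      right_convex_on_PL decseq_PL by simp
qed

end
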